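(* Let $\mathcal{A},\mathcal{B}\in\mathbb{C}^{I_1\times\cdots\times I_N\times I_1\times\cdots\times I_N}$, and let $\mathcal{M},\mathcal{N}\in\mathbb{C}^{I_1\times\cdots\times I_N\times I_1\times\cdots\times I_N}$ be Hermitian positive definite tensors. If (i) $(\mathcal{M}*_N\mathcal{A}*_N\mathcal{B}*_N\mathcal{B}^{\dagger}_{\mathcal{M}\mathcal{N}}*_N\mathcal{A}^{\dagger}_{\mathcal{M}\mathcal{N}})^H=\mathcal{M}*_N\mathcal{A}*_N\mathcal{B}*_N\mathcal{B}^{\dagger}_{\mathcal{M}\mathcal{N}}*_N\mathcal{A}^{\dagger}_{\mathcal{M}\mathcal{N}}$, (ii) $\mathcal{B}*_N(\mathcal{A}^{\dagger}_{\mathcal{M}\mathcal{N}}*_N\mathcal{A})=(\mathcal{A}^{\dagger}_{\mathcal{M}\mathcal{N}}*_N\mathcal{A})*_N\mathcal{B}$, and (iii) $\mathcal{B}^{\dagger}_{\mathcal{M}\mathcal{N}}*_N(\mathcal{A}^{\dagger}_{\mathcal{M}\mathcal{N}}*_N\mathcal{A})=(\mathcal{A}^{\dagger}_{\mathcal{M}\mathcal{N}}*_N\mathcal{A})*_N\mathcal{B}^{\dagger}_{\mathcal{M}\mathcal{N}}$, then $(\mathcal{A}*_N\mathcal{B})^{\dagger}_{\mathcal{M}\mathcal{N}}=\mathcal{B}^{\dagger}_{\mathcal{M}\mathcal{N}}*_N\mathcal{A}^{\dagger}_{\mathcal{M}\mathcal{N}}$.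
   Context: For tensors $\mathcal{A},\mathcal{B}\in\mathbb{C}^{I_1\times\cdots\times I_N\times I_1\times\cdots\times I_N}$ the Einstein product is $(\mathcal{A}*_N\mathcal{B})_{i_1\cdots i_Nk_1\cdots k_N}=\sum_{j_1,\dots,j_N}a_{i_1\cdots i_Nj_1\cdots j_N}b_{j_1\cdots j_Nk_1\cdots k_N}$. The conjugate transpose is $(\mathcal{A}^H)_{j_1\cdots j_Ni_1\cdots i_N}=\overline{a_{i_1\cdots i_Nj_1\cdots j_N}}$. The identity tensor $\mathcal{I}$ has entries $\prod_{k}\delta_{i_kj_k}$; $\mathcal{U}$ is unitary if $\mathcal{U}*_N\mathcal{U}^H=\mathcal{U}^H*_N\mathcal{U}=\mathcal{I}$; $\mathcal{D}$ is diagonal if $d_{i_1\cdots i_Nj_1\cdots j_N}=0$ whenever $(i_1,\dots,i_N)\ne(j_1,\dots,j_N)$. A tensor $\mathcal{P}$ is Hermitian positive definite if $\mathcal{P}=\mathcal{U}*_N\mathcal{D}*_N\mathcal{U}^H$ with $\mathcal{U}$ unitary and $\mathcal{D}$ diagonal with positive diagonal entries. For Hermitian positive definite $\mathcal{M},\mathcal{N}$, the weighted Moore--Penrose inverse $\mathcal{A}^{\dagger}_{\mathcal{M}\mathcal{N}}$ is the unique tensor $\mathcal{X}\in\mathbb{C}^{I_1\times\cdots\times I_N\times I_1\times\cdots\times I_N}$ satisfying $\mathcal{A}*_N\mathcal{X}*_N\mathcal{A}=\mathcal{A}$, $\mathcal{X}*_N\mathcal{A}*_N\mathcal{X}=\mathcal{X}$,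 $(\mathcal{M}*_N\mathcal{A}*_N\mathcal{X})^H=\mathcal{M}*_N\mathcal{A}*_N\mathcal{X}$, $(\mathcal{N}*_N\mathcal{X}*_N\mathcal{A})^H=\mathcal{N}*_N\mathcal{X}*_N\mathcal{A}$. *)

theory Defs
  imports Complex_Main "HOL-Library.FuncSet"
begin

text \<open>
  The order \<open>n\<close> and the dimensions \<open>I 1, \<dots>, I n\<close> are arbitrary; values of \<open>I\<close> outside \<open>{1..n}\<close>
  are irrelevant. A multi-index \<open>(i\<^sub>1, \<dots>, i\<^sub>n)\<close> is an extensional function on \<open>{1..n}\<close>.
\<close>

definition multi_index :: "nat \<Rightarrow> (nat \<Rightarrow> nat) \<Rightarrow> (nat \<Rightarrow> nat) set" where
  "multi_index n I = (\<Pi>\<^sub>E k\<in>{1..n}. {1..I k})"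

type_synonym tensor = "(nat \<Rightarrow> nat) \<Rightarrow> (nat \<Rightarrow> nat) \<Rightarrow> complex"

text \<open>
  The set of complex tensors of size \<open>I 1 \<times> \<dots> \<times> I n \<times> I 1 \<times> \<dots> \<times> I n\<close>. Entries outside the index range
  are required to be 0, so that HOL equality of two tensors is entrywise equality.
\<close>

definition tensors :: "nat \<Rightarrow> (nat \<Rightarrow> nat) \<Rightarrow> tensor set" where
  "tensors n I = {A. \<forall>i j. i \<notin> multi_index n I \<or> j \<notin> multi_index n I \<longrightarrow> A i j = 0}"

definition einstein_prod :: "nat \<Rightarrow> (nat \<Rightarrow> nat) \<Rightarrow> tensor \<Rightarrow> tensor \<Rightarrow> tensor" where
  "einstein_prod n I A B = (\<lambda>i k. \<Sum>j\<in>multi_index n I. A i j * B j k)"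

abbreviation einstein_prod_syntax ::
    "tensor \<Rightarrow> nat \<Rightarrow> (nat \<Rightarrow> nat) \<Rightarrow> tensor \<Rightarrow> tensor"
    ("(_ \<star>\<^bsub>_,_\<^esub> _)" [70, 0, 0, 71] 70) where
  "A \<star>\<^bsub>n,I\<^esub> B \<equiv> einstein_prod n I A B"

definition conj_transpose :: "tensor \<Rightarrow> tensor" ("(_\<^sup>H)" [1000] 999) where
  "A\<^sup>H = (\<lambda>j i. cnj (A i j))"

definition id_tensor :: "nat \<Rightarrow> (nat \<Rightarrow> nat) \<Rightarrow> tensor" where
  "id_tensor n I = (\<lambda>i j. if i \<in> multi_index n I \<and> j \<in> multi_index n I
     then \<Prod>k=1..n. (if i k = j k then 1 else 0) else 0)"

definition unitary_tensor :: "nat \<Rightarrow> (nat \<Rightarrow> nat) \<Rightarrow> tensor \<Rightarrow> bool" where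
  "unitary_tensor n I U \<longleftrightarrow> U \<in> tensors n I \<and>
     U \<star>\<^bsub>n,I\<^esub> U\<^sup>H = id_tensor n I \<and> U\<^sup>H \<star>\<^bsub>n,I\<^esub> U = id_tensor n I"

definition diagonal_tensor :: "nat \<Rightarrow> (nat \<Rightarrow> nat) \<Rightarrow> tensor \<Rightarrow> bool" where
  "diagonal_tensor n I D \<longleftrightarrow> D \<in> tensors n I \<and>
     (\<forall>i\<in>multi_index n I. \<forall>j\<in>multi_index n I. i \<noteq> j \<longrightarrow> D i j = 0)"

definition hermitian_pos_def :: "nat \<Rightarrow> (nat \<Rightarrow> nat) \<Rightarrow> tensor \<Rightarrow> bool" where
  "hermitian_pos_def n I P \<longleftrightarrow> P \<in> tensors n I \<and>
     (\<exists>U D. unitary_tensor n I U \<and> diagonal_tensor n I D \<and>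
        (\<forall>i\<in>multi_index n I. D i i \<in> \<real> \<and> 0 < Re (D i i)) \<and>
        P = U \<star>\<^bsub>n,I\<^esub> D \<star>\<^bsub>n,I\<^esub> U\<^sup>H)"

definition is_weighted_MP_inverse ::
    "nat \<Rightarrow> (nat \<Rightarrow> nat) \<Rightarrow> tensor \<Rightarrow> tensor \<Rightarrow> tensor \<Rightarrow> tensor \<Rightarrow> bool" where
  "is_weighted_MP_inverse n I M N A X \<longleftrightarrow> X \<in> tensors n I \<and>
     A \<star>\<^bsub>n,I\<^esub> X \<star>\<^bsub>n,I\<^esub> A = A \<and>
     X \<star>\<^bsub>n,I\<^esub> A \<star>\<^bsub>n,I\<^esub> X = X \<and>
     (M \<star>\<^bsub>n,I\<^esub> A \<star>\<^bsub>n,I\<^esub> X)\<^sup>H = M \<star>\<^bsub>n,I\<^esub> A \<star>\<^bsub>n,I\<^esub> X \<and>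
     (N \<star>\<^bsub>n,I\<^esub> X \<star>\<^bsub>n,I\<^esub> A)\<^sup>H = N \<star>\<^bsub>n,I\<^esub> X \<star>\<^bsub>n,I\<^esub> A"

text \<open>
  The tensor below exists and is unique whenever \<open>A\<close> is a tensor and \<open>M\<close>, \<open>N\<close> are Hermitian
  positive definite.
\<close>

definition weighted_MP_inverse ::
    "nat \<Rightarrow> (nat \<Rightarrow> nat) \<Rightarrow> tensor \<Rightarrow> tensor \<Rightarrow> tensor \<Rightarrow> tensor" where
  "weighted_MP_inverse n I M N A = (THE X. is_weighted_MP_inverse n I M N A X)"

abbreviation weighted_MP_inverse_syntax ::
    "tensor \<Rightarrow> nat \<Rightarrow> (nat \<Rightarrow> nat) \<Rightarrow> tensor \<Rightarrow> tensor \<Rightarrow> tensor"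
    ("(_\<^sup>\<dagger>\<^bsub>_,_;_,_\<^esub>)" [1000, 0, 0, 0, 0] 999) where
  "A\<^sup>\<dagger>\<^bsub>n,I;M,N\<^esub> \<equiv> weighted_MP_inverse n I M N A"

end

theory Submission
  imports Defs "HOL-Library.Function_Algebras"
begin

text \<open>
  The weighted Moore--Penrose inverse is a \<open>THE\<close>-term, so its existence has to be shown. A nonzero
  entry of \<open>A\<close> yields a tensor \<open>E\<close> for which \<open>A - A E A\<close> has fewer nonzero rows, and from an inner inverse
  of that tensor one obtains an inner inverse of \<open>A\<close>. Inner inverses of \<open>A\<^sup>H A\<close> and \<open>A A\<^sup>H\<close> provide the
  orthogonal projections onto the ranges of \<open>A\<close> and \<open>A\<^sup>H\<close>, and hence the ordinary Moore--Penrose inverse.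
  Writing \<open>M = R\<^sup>H R\<close> and \<open>N = S\<^sup>H S\<close> with \<open>R\<close>, \<open>S\<close> invertible, the weighted inverse of \<open>A\<close> is
  \<open>S\<^sup>-\<^sup>1 (R A S\<^sup>-\<^sup>1)\<^sup>\<dagger> R\<close>. With existence and uniqueness available, the four defining equations for
  \<open>B\<^sup>\<dagger> A\<^sup>\<dagger>\<close> follow by commuting \<open>A\<^sup>\<dagger> A\<close> past \<open>B\<close> and \<open>B\<^sup>\<dagger>\<close>.
\<close>

section \<open>Algebra of the Einstein product and the conjugate transpose\<close>

lemma finite_multi_index: "finite (multi_index n I)"
  unfolding multi_index_def by (intro finite_PiE) auto

lemma einstein_prod_assoc: "A \<star>\<^bsub>n,I\<^esub> B \<star>\<^bsub>n,I\<^esub> C = A \<star>\<^bsub>n,I\<^esub> (B \<star>\<^bsub>n,I\<^esub> C)"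
  unfolding einstein_prod_def
  by (intro ext, simp add: sum_distrib_left sum_distrib_right mult.assoc, rule sum.swap)

text \<open>Here \<open>+\<close>, \<open>-\<close> and \<open>0\<close> are the pointwise
  operations on functions, so this law and the similar ones below reduce entrywise to linearity of
  finite sums.\<close>

lemma einstein_prod_diff_left: "(A - B) \<star>\<^bsub>n,I\<^esub> C = A \<star>\<^bsub>n,I\<^esub> C - B \<star>\<^bsub>n,I\<^esub> C"
  by (intro ext) (simp add: einstein_prod_def left_diff_distrib sum_subtractf)

lemma einstein_prod_diff_right: "A \<star>\<^bsub>n,I\<^esub> (B - C) = A \<star>\<^bsub>n,I\<^esub> B - A \<star>\<^bsub>n,I\<^esub> C"
  by (intro ext) (simp add: einstein_prod_def right_diff_distrib sum_subtractf)

lemma einstein_prod_add_left: "(A + B) \<star>\<^bsub>n,I\<^esub> C = A \<star>\<^bsub>n,I\<^esub> C + B \<star>\<^bsub>n,I\<^esub> C"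
  by (intro ext) (simp add: einstein_prod_def distrib_right sum.distrib)

lemma einstein_prod_add_right: "A \<star>\<^bsub>n,I\<^esub> (B + C) = A \<star>\<^bsub>n,I\<^esub> B + A \<star>\<^bsub>n,I\<^esub> C"
  by (intro ext) (simp add: einstein_prod_def distrib_left sum.distrib)

lemma einstein_prod_zero [simp]: "0 \<star>\<^bsub>n,I\<^esub> A = 0" "A \<star>\<^bsub>n,I\<^esub> 0 = 0"
  by (intro ext, simp add: einstein_prod_def)+

lemmas einstein_prod_algebra = einstein_prod_assoc
  einstein_prod_diff_left einstein_prod_diff_right einstein_prod_add_left einstein_prod_add_right

lemma conj_transpose_prod: "(A \<star>\<^bsub>n,I\<^esub> B)\<^sup>H = B\<^sup>H \<star>\<^bsub>n,I\<^esub> A\<^sup>H"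
  by (intro ext) (simp add: einstein_prod_def conj_transpose_def mult.commute)

lemma conj_transpose_conj_transpose [simp]: "(A\<^sup>H)\<^sup>H = A"
  by (simp add: conj_transpose_def)

text \<open>Conjugate transposition reverses the three factors and exchanges the outer two. This
  turns the plain Hermitian conditions on \<open>C Y\<close> and \<open>Y C\<close> into the
  weighted ones when the weighted inverse is constructed.\<close>

lemma hermitian_congruence: "K\<^sup>H = K \<Longrightarrow> (R\<^sup>H \<star>\<^bsub>n,I\<^esub> K \<star>\<^bsub>n,I\<^esub> R)\<^sup>H = R\<^sup>H \<star>\<^bsub>n,I\<^esub> K \<star>\<^bsub>n,I\<^esub> R"
  by (simp add: conj_transpose_prod einstein_prod_assoc)

lemma tensors_prod [intro, simp]: "A \<in> tensors n I \<Longrightarrow> B \<in> tensors n I \<Longrightarrow> A \<star>\<^bsub>n,I\<^esub> B \<in> tensors n I"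
  by (auto simp: tensors_def einstein_prod_def)

lemma tensors_conj_transpose [intro, simp]: "A \<in> tensors n I \<Longrightarrow> A\<^sup>H \<in> tensors n I"
  by (auto simp: tensors_def conj_transpose_def)

lemma tensors_diff [intro, simp]: "A \<in> tensors n I \<Longrightarrow> B \<in> tensors n I \<Longrightarrow> A - B \<in> tensors n I"
  by (auto simp: tensors_def)

lemma tensors_add [intro, simp]: "A \<in> tensors n I \<Longrightarrow> B \<in> tensors n I \<Longrightarrow> A + B \<in> tensors n I"
  by (auto simp: tensors_def)

section \<open>Diagonal tensors and the identity tensor\<close>

text \<open>Describing a diagonal tensor by a function on multi-indices makes products and conjugate
  transposes pointwise operations on that function; square roots and inverses are then taken entry
  by entry.\<close>

definition diag_tensor :: "nat \<Rightarrow> (nat \<Rightarrow> nat) \<Rightarrow> ((nat \<Rightarrow> nat) \<Rightarrow> complex) \<Rightarrow> tensor" where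
  "diag_tensor n I d = (\<lambda>i j. if i = j \<and> i \<in> multi_index n I then d i else 0)"

lemma tensors_diag_tensor [intro, simp]: "diag_tensor n I d \<in> tensors n I"
  by (auto simp: tensors_def diag_tensor_def)

lemma diag_tensor_cong:
  "(\<And>i. i \<in> multi_index n I \<Longrightarrow> d i = e i) \<Longrightarrow> diag_tensor n I d = diag_tensor n I e"
  unfolding diag_tensor_def by (intro ext if_cong) auto

lemma diag_tensor_prod_left:
  "(diag_tensor n I d \<star>\<^bsub>n,I\<^esub> A) i k = (if i \<in> multi_index n I then d i * A i k else 0)"
proof -
  have "(diag_tensor n I d \<star>\<^bsub>n,I\<^esub> A) i k = (\<Sum>j\<in>multi_index n I. if j = i then d i * A i k else 0)"
    unfolding einstein_prod_def diag_tensor_def by (intro sum.cong) auto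
  then show ?thesis
    by (simp add: finite_multi_index)
qed

lemma diag_tensor_prod:
  "diag_tensor n I d \<star>\<^bsub>n,I\<^esub> diag_tensor n I e = diag_tensor n I (\<lambda>i. d i * e i)"
  by (intro ext, subst diag_tensor_prod_left) (auto simp: diag_tensor_def)

lemma conj_transpose_diag_tensor: "(diag_tensor n I d)\<^sup>H = diag_tensor n I (\<lambda>i. cnj (d i))"
  unfolding diag_tensor_def conj_transpose_def by (intro ext) auto

lemma diagonal_tensor_eq_diag_tensor:
  "diagonal_tensor n I D \<Longrightarrow> D = diag_tensor n I (\<lambda>i. D i i)"
  unfolding diagonal_tensor_def tensors_def diag_tensor_def by (intro ext) auto

lemma id_tensor_eq_diag_tensor: "id_tensor n I = diag_tensor n I (\<lambda>_. 1)"
proof (intro ext)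
  fix i j
  \<comment> \<open>Multi-indices are extensional, so distinct ones differ at a position in
    \<open>{1..n}\<close>; this puts a zero factor into the product of Kronecker deltas.\<close>
  have "\<exists>k\<in>{1..n}. i k \<noteq> j k" if "i \<in> multi_index n I" "j \<in> multi_index n I" "i \<noteq> j"
    using that PiE_ext unfolding multi_index_def by blast
  then show "id_tensor n I i j = diag_tensor n I (\<lambda>_. 1) i j"
    by (auto simp: id_tensor_def diag_tensor_def)
qed

lemma tensors_id_tensor [intro, simp]: "id_tensor n I \<in> tensors n I"
  by (simp add: id_tensor_eq_diag_tensor)

lemma conj_transpose_id_tensor: "(id_tensor n I)\<^sup>H = id_tensor n I"
  by (simp add: id_tensor_eq_diag_tensor conj_transpose_diag_tensor)

lemma id_tensor_left: "A \<in> tensors n I \<Longrightarrow> id_tensor n I \<star>\<^bsub>n,I\<^esub> A = A"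
  unfolding id_tensor_eq_diag_tensor
  by (intro ext, subst diag_tensor_prod_left) (auto simp: tensors_def)

text \<open>The mirror image of \<open>id_tensor_left\<close> under conjugate transposition.\<close>

lemma id_tensor_right: "A \<in> tensors n I \<Longrightarrow> A \<star>\<^bsub>n,I\<^esub> id_tensor n I = A"
  by (metis conj_transpose_conj_transpose conj_transpose_id_tensor conj_transpose_prod
      id_tensor_left tensors_conj_transpose)

section \<open>Inner inverses\<close>

text \<open>Rank-one reduction: subtracting a suitable \<open>A E A\<close> clears one row without
  filling another, and an inner inverse of the remainder can be corrected to one of
  \<open>A\<close>.\<close>

lemma ex_inner_inverse:
  assumes "A \<in> tensors n I"
  shows "\<exists>G\<in>tensors n I. A \<star>\<^bsub>n,I\<^esub> G \<star>\<^bsub>n,I\<^esub> A = A"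
proof -
  \<comment> \<open>The set \<open>K\<close> contains every nonzero row and carries the induction;
    \<open>A\<close> stays arbitrary because the step passes to a different tensor.\<close>
  have "finite K \<Longrightarrow> A \<in> tensors n I \<Longrightarrow> (\<And>i j. i \<notin> K \<Longrightarrow> A i j = 0) \<Longrightarrow>
      \<exists>G\<in>tensors n I. A \<star>\<^bsub>n,I\<^esub> G \<star>\<^bsub>n,I\<^esub> A = A" for K
  proof (induction K arbitrary: A rule: finite_induct)
    case empty
    then have "A = 0"
      by (auto simp: fun_eq_iff)
    \<comment> \<open>The zero tensor is its own inner inverse.\<close>
    then have "A \<star>\<^bsub>n,I\<^esub> A \<star>\<^bsub>n,I\<^esub> A = A"
      by (simp only: einstein_prod_zero)
    with empty.prems(1) show ?case
      by blast
  next
    case (insert i K)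
    show ?case
    proof (cases "\<exists>j. A i j \<noteq> 0")
      case False
      then have "A i' j = 0" if "i' \<notin> K" for i' j
        using insert.prems(2)[of i' j] that by (cases "i' = i") auto
      then show ?thesis
        by (intro insert.IH insert.prems(1))
    next
      case True
      then obtain j where j: "A i j \<noteq> 0"
        by blast
      then have mem: "i \<in> multi_index n I" "j \<in> multi_index n I"
        using insert.prems(1) unfolding tensors_def by blast+
      \<comment> \<open>The single entry of \<open>E\<close> sits at the transposed position of the
        pivot \<open>A i j\<close> and is its reciprocal. Thus \<open>A E A\<close> is column
        \<open>j\<close> times row \<open>i\<close> of \<open>A\<close>, scaled to agree with
        \<open>A\<close> in row \<open>i\<close>.\<close>
      define E :: tensor where "E = (\<lambda>k l. if k = j \<and> l = i then 1 / A i j else 0)"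
      have E: "E \<in> tensors n I"
        using mem by (auto simp: tensors_def E_def)
      have AE: "(A \<star>\<^bsub>n,I\<^esub> E) k l = (if l = i then A k j / A i j else 0)" for k l
      proof -
        have "(A \<star>\<^bsub>n,I\<^esub> E) k l =
            (\<Sum>m\<in>multi_index n I. if m = j then (if l = i then A k j / A i j else 0) else 0)"
          unfolding einstein_prod_def E_def by (intro sum.cong) auto
        then show ?thesis
          using mem by (simp add: finite_multi_index)
      qed
      have AEA: "(A \<star>\<^bsub>n,I\<^esub> E \<star>\<^bsub>n,I\<^esub> A) k l = A k j / A i j * A i l" for k l
      proof -
        have "(A \<star>\<^bsub>n,I\<^esub> E \<star>\<^bsub>n,I\<^esub> A) k l =
            (\<Sum>m\<in>multi_index n I. if m = i then A k j / A i j * A i l else 0)"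
          \<comment> \<open>Only the outer product is unfolded; the inner one is evaluated by
            \<open>AE\<close>.\<close>
          unfolding einstein_prod_def[of n I "A \<star>\<^bsub>n,I\<^esub> E"] AE by (intro sum.cong) auto
        then show ?thesis
          using mem by (simp add: finite_multi_index)
      qed
      define C where "C = A - A \<star>\<^bsub>n,I\<^esub> E \<star>\<^bsub>n,I\<^esub> A"
      have C: "C \<in> tensors n I"
        unfolding C_def using insert.prems(1) E by simp
      \<comment> \<open>Row \<open>i\<close> cancels by the choice of \<open>E\<close>. Any other
        row outside \<open>K\<close> is zero in \<open>A\<close>, so its factor \<open>A k j\<close>
        in \<open>A E A\<close> is zero too.\<close>
      have "C k l = 0" if "k \<notin> K" for k l
        using that j insert.prems(2)[of k] by (cases "k = i") (auto simp: C_def AEA)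
      from insert.IH[OF C this] obtain G where G: "G \<in> tensors n I" "C \<star>\<^bsub>n,I\<^esub> G \<star>\<^bsub>n,I\<^esub> C = C"
        by blast
      \<comment> \<open>This is \<open>(1 - E A) G (1 - A E) + E\<close> multiplied out. Since
        \<open>C = A (1 - E A) = (1 - A E) A\<close>, the first summand contributes
        \<open>C G C\<close> to \<open>A X A\<close>.\<close>
      define X where "X = G - E \<star>\<^bsub>n,I\<^esub> A \<star>\<^bsub>n,I\<^esub> G - G \<star>\<^bsub>n,I\<^esub> A \<star>\<^bsub>n,I\<^esub> E + E \<star>\<^bsub>n,I\<^esub> A \<star>\<^bsub>n,I\<^esub> G \<star>\<^bsub>n,I\<^esub> A \<star>\<^bsub>n,I\<^esub> E + E"
      have "A \<star>\<^bsub>n,I\<^esub> X \<star>\<^bsub>n,I\<^esub> A = C \<star>\<^bsub>n,I\<^esub> G \<star>\<^bsub>n,I\<^esub> C + A \<star>\<^bsub>n,I\<^esub> E \<star>\<^bsub>n,I\<^esub> A"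
        by (simp add: X_def C_def einstein_prod_algebra)
      also have "\<dots> = A"
        unfolding G(2) by (simp add: C_def)
      finally have "A \<star>\<^bsub>n,I\<^esub> X \<star>\<^bsub>n,I\<^esub> A = A" .
      moreover have "X \<in> tensors n I"
        unfolding X_def using G(1) E insert.prems(1)
        by (intro tensors_add tensors_diff tensors_prod)
      ultimately show ?thesis
        by blast
    qed
  qed
  from this[of "multi_index n I"] assms show ?thesis
    by (auto simp: finite_multi_index tensors_def)
qed

section \<open>Orthogonal projections and the ordinary Moore--Penrose inverse\<close>

text \<open>The diagonal entry of \<open>A\<^sup>H A\<close> at \<open>k\<close> is the sum of the
  squared moduli in column \<open>k\<close> of \<open>A\<close>.\<close>

lemma conj_transpose_prod_eq_zero:
  assumes "A \<in> tensors n I" and "A\<^sup>H \<star>\<^bsub>n,I\<^esub> A = 0"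
  shows "A = 0"
proof (intro ext)
  fix i k
  have "(\<Sum>j\<in>multi_index n I. complex_of_real ((cmod (A j k))\<^sup>2)) = (A\<^sup>H \<star>\<^bsub>n,I\<^esub> A) k k"
    unfolding einstein_prod_def conj_transpose_def
    by (intro sum.cong refl) (metis complex_norm_square mult.commute)
  also have "\<dots> = 0"
    by (simp add: assms(2))
  finally have "(\<Sum>j\<in>multi_index n I. (cmod (A j k))\<^sup>2) = 0"
    by (simp flip: of_real_sum of_real_power)
  then have "\<forall>j\<in>multi_index n I. A j k = 0"
    by (simp add: sum_nonneg_eq_0_iff finite_multi_index)
  then show "A i k = 0 i k"
    using assms(1) by (auto simp: tensors_def)
qed

text \<open>With \<open>Z = A (B - C)\<close>, the assumption gives \<open>Z\<^sup>H Z = 0\<close>,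
  hence \<open>Z = 0\<close>.\<close>

lemma conj_transpose_prod_cancel:
  assumes "A \<in> tensors n I" "B \<in> tensors n I" "C \<in> tensors n I"
    and "A\<^sup>H \<star>\<^bsub>n,I\<^esub> A \<star>\<^bsub>n,I\<^esub> B = A\<^sup>H \<star>\<^bsub>n,I\<^esub> A \<star>\<^bsub>n,I\<^esub> C"
  shows "A \<star>\<^bsub>n,I\<^esub> B = A \<star>\<^bsub>n,I\<^esub> C"
proof -
  have "(A \<star>\<^bsub>n,I\<^esub> (B - C))\<^sup>H \<star>\<^bsub>n,I\<^esub> (A \<star>\<^bsub>n,I\<^esub> (B - C)) = (B - C)\<^sup>H \<star>\<^bsub>n,I\<^esub> (A\<^sup>H \<star>\<^bsub>n,I\<^esub> A \<star>\<^bsub>n,I\<^esub> (B - C))"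
    by (simp only: conj_transpose_prod einstein_prod_assoc)
  also have "\<dots> = (B - C)\<^sup>H \<star>\<^bsub>n,I\<^esub> (A\<^sup>H \<star>\<^bsub>n,I\<^esub> A \<star>\<^bsub>n,I\<^esub> B - A\<^sup>H \<star>\<^bsub>n,I\<^esub> A \<star>\<^bsub>n,I\<^esub> C)"
    by (simp only: einstein_prod_diff_right)
  also have "\<dots> = 0"
    by (simp add: assms(4))
  finally have "A \<star>\<^bsub>n,I\<^esub> (B - C) = 0"
    by (rule conj_transpose_prod_eq_zero[rotated]) (intro tensors_prod tensors_diff assms)
  then show ?thesis
    by (simp add: einstein_prod_diff_right)
qed

text \<open>Any inner inverse \<open>G\<close> of \<open>A\<^sup>H A\<close> works:
  \<open>A G A\<^sup>H\<close> is the orthogonal projection onto the range of \<open>A\<close>, even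
  if \<open>G\<close> itself is not Hermitian.\<close>

lemma ex_range_projection:
  assumes "A \<in> tensors n I"
  shows "\<exists>G\<in>tensors n I. A \<star>\<^bsub>n,I\<^esub> G \<star>\<^bsub>n,I\<^esub> A\<^sup>H \<star>\<^bsub>n,I\<^esub> A = A \<and> (A \<star>\<^bsub>n,I\<^esub> G \<star>\<^bsub>n,I\<^esub> A\<^sup>H)\<^sup>H = A \<star>\<^bsub>n,I\<^esub> G \<star>\<^bsub>n,I\<^esub> A\<^sup>H"
proof -
  \<comment> \<open>Stated for a general \<open>F\<close> because it is applied to both
    \<open>G\<close> and \<open>G\<^sup>H\<close>; the leading \<open>A\<^sup>H\<close> of the
    second assumption is cancelled.\<close>
  have fixes_range: "A \<star>\<^bsub>n,I\<^esub> F \<star>\<^bsub>n,I\<^esub> A\<^sup>H \<star>\<^bsub>n,I\<^esub> A = A"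
    if "F \<in> tensors n I" "A\<^sup>H \<star>\<^bsub>n,I\<^esub> A \<star>\<^bsub>n,I\<^esub> F \<star>\<^bsub>n,I\<^esub> (A\<^sup>H \<star>\<^bsub>n,I\<^esub> A) = A\<^sup>H \<star>\<^bsub>n,I\<^esub> A" for F
  proof -
    have "A \<star>\<^bsub>n,I\<^esub> (F \<star>\<^bsub>n,I\<^esub> A\<^sup>H \<star>\<^bsub>n,I\<^esub> A) = A \<star>\<^bsub>n,I\<^esub> id_tensor n I"
      by (rule conj_transpose_prod_cancel)
        (use assms that in \<open>auto simp: einstein_prod_assoc id_tensor_right\<close>)
    then show ?thesis
      using assms by (simp add: einstein_prod_assoc id_tensor_right)
  qed
  obtain G where G: "G \<in> tensors n I" "A\<^sup>H \<star>\<^bsub>n,I\<^esub> A \<star>\<^bsub>n,I\<^esub> G \<star>\<^bsub>n,I\<^esub> (A\<^sup>H \<star>\<^bsub>n,I\<^esub> A) = A\<^sup>H \<star>\<^bsub>n,I\<^esub> A"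
    using ex_inner_inverse[of "A\<^sup>H \<star>\<^bsub>n,I\<^esub> A" n I] assms by auto
  have "(A\<^sup>H \<star>\<^bsub>n,I\<^esub> A \<star>\<^bsub>n,I\<^esub> G \<star>\<^bsub>n,I\<^esub> (A\<^sup>H \<star>\<^bsub>n,I\<^esub> A))\<^sup>H = (A\<^sup>H \<star>\<^bsub>n,I\<^esub> A)\<^sup>H"
    using G(2) by simp
  then have GH: "A\<^sup>H \<star>\<^bsub>n,I\<^esub> A \<star>\<^bsub>n,I\<^esub> G\<^sup>H \<star>\<^bsub>n,I\<^esub> (A\<^sup>H \<star>\<^bsub>n,I\<^esub> A) = A\<^sup>H \<star>\<^bsub>n,I\<^esub> A"
    by (simp add: conj_transpose_prod einstein_prod_assoc)
  define Q where "Q = A \<star>\<^bsub>n,I\<^esub> G \<star>\<^bsub>n,I\<^esub> A\<^sup>H"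
  have QH: "Q\<^sup>H = A \<star>\<^bsub>n,I\<^esub> G\<^sup>H \<star>\<^bsub>n,I\<^esub> A\<^sup>H"
    by (simp add: Q_def conj_transpose_prod einstein_prod_assoc)
  have "Q\<^sup>H \<star>\<^bsub>n,I\<^esub> A = A"
    using fixes_range[of "G\<^sup>H"] GH G(1) by (simp add: QH)
  \<comment> \<open>\<open>Q\<close> begins with the factor \<open>A\<close>, which
    \<open>Q\<^sup>H\<close> fixes. As \<open>Q\<^sup>H Q\<close> is always Hermitian, so is
    \<open>Q\<close>.\<close>
  then have "Q\<^sup>H \<star>\<^bsub>n,I\<^esub> Q = Q"
    unfolding Q_def by (metis einstein_prod_assoc)
  then have "Q\<^sup>H = Q"
    by (metis conj_transpose_conj_transpose conj_transpose_prod)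
  then show ?thesis
    using fixes_range[OF G] G(1) unfolding Q_def by blast
qed

text \<open>The inverse is built so that \<open>A X\<close> and \<open>X A\<close> become the
  orthogonal projections onto the ranges of \<open>A\<close> and \<open>A\<^sup>H\<close>.\<close>

lemma ex_MP_inverse:
  assumes "A \<in> tensors n I"
  shows "\<exists>X\<in>tensors n I. A \<star>\<^bsub>n,I\<^esub> X \<star>\<^bsub>n,I\<^esub> A = A \<and> X \<star>\<^bsub>n,I\<^esub> A \<star>\<^bsub>n,I\<^esub> X = X \<and> (A \<star>\<^bsub>n,I\<^esub> X)\<^sup>H = A \<star>\<^bsub>n,I\<^esub> X \<and> (X \<star>\<^bsub>n,I\<^esub> A)\<^sup>H = X \<star>\<^bsub>n,I\<^esub> A"
proof -
  obtain G where G: "G \<in> tensors n I" "A \<star>\<^bsub>n,I\<^esub> G \<star>\<^bsub>n,I\<^esub> A\<^sup>H \<star>\<^bsub>n,I\<^esub> A = A" "(A \<star>\<^bsub>n,I\<^esub> G \<star>\<^bsub>n,I\<^esub> A\<^sup>H)\<^sup>H = A \<star>\<^bsub>n,I\<^esub> G \<star>\<^bsub>n,I\<^esub> A\<^sup>H"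
    using ex_range_projection[OF assms] by blast
  obtain F where F: "F \<in> tensors n I" "A\<^sup>H \<star>\<^bsub>n,I\<^esub> F \<star>\<^bsub>n,I\<^esub> A \<star>\<^bsub>n,I\<^esub> A\<^sup>H = A\<^sup>H" "(A\<^sup>H \<star>\<^bsub>n,I\<^esub> F \<star>\<^bsub>n,I\<^esub> A)\<^sup>H = A\<^sup>H \<star>\<^bsub>n,I\<^esub> F \<star>\<^bsub>n,I\<^esub> A"
    using ex_range_projection[of "A\<^sup>H" n I] assms by auto
  \<comment> \<open>The conjugate transpose of \<open>F(2)\<close>, the projection being Hermitian
    by \<open>F(3)\<close>.\<close>
  have AP: "A \<star>\<^bsub>n,I\<^esub> (A\<^sup>H \<star>\<^bsub>n,I\<^esub> F \<star>\<^bsub>n,I\<^esub> A) = A"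
    by (metis F(2,3) conj_transpose_conj_transpose conj_transpose_prod)
  \<comment> \<open>The two projections \<open>A\<^sup>H F A\<close> and
    \<open>A G A\<^sup>H\<close> overlap in the middle \<open>A\<close>: from the left,
    \<open>A\<close> absorbs the first, and from the right, the second absorbs into
    \<open>A\<close>.\<close>
  define X where "X = A\<^sup>H \<star>\<^bsub>n,I\<^esub> F \<star>\<^bsub>n,I\<^esub> A \<star>\<^bsub>n,I\<^esub> G \<star>\<^bsub>n,I\<^esub> A\<^sup>H"
  have AX: "A \<star>\<^bsub>n,I\<^esub> X = A \<star>\<^bsub>n,I\<^esub> G \<star>\<^bsub>n,I\<^esub> A\<^sup>H"
    using AP by (metis X_def einstein_prod_assoc)
  have XA: "X \<star>\<^bsub>n,I\<^esub> A = A\<^sup>H \<star>\<^bsub>n,I\<^esub> F \<star>\<^bsub>n,I\<^esub> A"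
    using G(2) by (metis X_def einstein_prod_assoc)
  have "X \<star>\<^bsub>n,I\<^esub> A \<star>\<^bsub>n,I\<^esub> X = X"
    unfolding XA using F(2) by (metis X_def einstein_prod_assoc)
  moreover have "X \<in> tensors n I"
    unfolding X_def using assms F(1) G(1) by auto
  ultimately show ?thesis
    using AX XA G F by (intro bexI[of _ X]) auto
qed

section \<open>Factorization of Hermitian positive definite tensors\<close>

lemma hermitian_pos_def_factorization:
  assumes "hermitian_pos_def n I P"
  obtains R S where "R \<in> tensors n I" "S \<in> tensors n I" "P = R\<^sup>H \<star>\<^bsub>n,I\<^esub> R"
    "R \<star>\<^bsub>n,I\<^esub> S = id_tensor n I" "S \<star>\<^bsub>n,I\<^esub> R = id_tensor n I"
proof -
  obtain U D where U: "unitary_tensor n I U" and D: "diagonal_tensor n I D"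
    and pos: "\<And>i. i \<in> multi_index n I \<Longrightarrow> D i i \<in> \<real> \<and> 0 < Re (D i i)"
    and P: "P = U \<star>\<^bsub>n,I\<^esub> D \<star>\<^bsub>n,I\<^esub> U\<^sup>H"
    using assms unfolding hermitian_pos_def_def by blast
  have U': "U \<in> tensors n I" "U \<star>\<^bsub>n,I\<^esub> U\<^sup>H = id_tensor n I" "U\<^sup>H \<star>\<^bsub>n,I\<^esub> U = id_tensor n I"
    using U unfolding unitary_tensor_def by auto
  \<comment> \<open>Entries are complex by type, so the root is taken of the real part;
    \<open>D i i \<in> \<real>\<close> makes its square equal to \<open>D i i\<close>, and
    positivity makes it nonzero.\<close>
  define d where "d = (\<lambda>i. complex_of_real (sqrt (Re (D i i))))"
  define E where "E = diag_tensor n I d"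
  define F where "F = diag_tensor n I (\<lambda>i. inverse (d i))"
  have d: "d i * d i = D i i" "d i \<noteq> 0" if "i \<in> multi_index n I" for i
    using pos[OF that] by (auto simp: d_def simp flip: of_real_mult)
  have EE: "E \<star>\<^bsub>n,I\<^esub> E = D"
    unfolding E_def diag_tensor_prod using d(1)
    by (subst diagonal_tensor_eq_diag_tensor[OF D]) (rule diag_tensor_cong)
  have EH: "E\<^sup>H = E"
    by (simp add: E_def conj_transpose_diag_tensor d_def)
  have EF: "E \<star>\<^bsub>n,I\<^esub> F = id_tensor n I" "F \<star>\<^bsub>n,I\<^esub> E = id_tensor n I"
    unfolding E_def F_def diag_tensor_prod id_tensor_eq_diag_tensor using d(2)
    by (auto intro!: diag_tensor_cong)
  have mem: "E \<in> tensors n I" "F \<in> tensors n I"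
    by (auto simp: E_def F_def)
  show thesis
  proof
    \<comment> \<open>The witnesses are \<open>R = E U\<^sup>H\<close> and its inverse
      \<open>S = U F\<close>, where \<open>E\<close> is the square root of \<open>D\<close> and
      \<open>F\<close> the inverse of \<open>E\<close>.\<close>
    show "E \<star>\<^bsub>n,I\<^esub> U\<^sup>H \<in> tensors n I" "U \<star>\<^bsub>n,I\<^esub> F \<in> tensors n I"
      using mem U'(1) by auto
    show "P = (E \<star>\<^bsub>n,I\<^esub> U\<^sup>H)\<^sup>H \<star>\<^bsub>n,I\<^esub> (E \<star>\<^bsub>n,I\<^esub> U\<^sup>H)"
      unfolding P EE[symmetric] by (simp add: conj_transpose_prod EH einstein_prod_assoc)
    have "E \<star>\<^bsub>n,I\<^esub> U\<^sup>H \<star>\<^bsub>n,I\<^esub> (U \<star>\<^bsub>n,I\<^esub> F) = E \<star>\<^bsub>n,I\<^esub> (U\<^sup>H \<star>\<^bsub>n,I\<^esub> U) \<star>\<^bsub>n,I\<^esub> F"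
      by (simp add: einstein_prod_assoc)
    then show "E \<star>\<^bsub>n,I\<^esub> U\<^sup>H \<star>\<^bsub>n,I\<^esub> (U \<star>\<^bsub>n,I\<^esub> F) = id_tensor n I"
      using U' mem EF by (simp add: id_tensor_right)
    have "U \<star>\<^bsub>n,I\<^esub> F \<star>\<^bsub>n,I\<^esub> (E \<star>\<^bsub>n,I\<^esub> U\<^sup>H) = U \<star>\<^bsub>n,I\<^esub> (F \<star>\<^bsub>n,I\<^esub> E) \<star>\<^bsub>n,I\<^esub> U\<^sup>H"
      by (simp add: einstein_prod_assoc)
    then show "U \<star>\<^bsub>n,I\<^esub> F \<star>\<^bsub>n,I\<^esub> (E \<star>\<^bsub>n,I\<^esub> U\<^sup>H) = id_tensor n I"
      using U' EF by (simp add: id_tensor_right)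
  qed
qed

lemma hermitian_pos_def_hermitian: "hermitian_pos_def n I P \<Longrightarrow> P\<^sup>H = P"
  by (metis hermitian_pos_def_factorization conj_transpose_prod conj_transpose_conj_transpose)

text \<open>Writing \<open>P = R\<^sup>H R\<close>, first \<open>R\<^sup>H\<close> is cancelled and
  then \<open>R\<close> by its left inverse.\<close>

lemma hermitian_pos_def_cancel:
  assumes "hermitian_pos_def n I P" "A \<in> tensors n I" "B \<in> tensors n I" "P \<star>\<^bsub>n,I\<^esub> A = P \<star>\<^bsub>n,I\<^esub> B"
  shows "A = B"
proof -
  obtain R S where R: "R \<in> tensors n I" "S \<in> tensors n I" "P = R\<^sup>H \<star>\<^bsub>n,I\<^esub> R"
    "R \<star>\<^bsub>n,I\<^esub> S = id_tensor n I" "S \<star>\<^bsub>n,I\<^esub> R = id_tensor n I"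
    using hermitian_pos_def_factorization[OF assms(1)] .
  have "R \<star>\<^bsub>n,I\<^esub> A = R \<star>\<^bsub>n,I\<^esub> B"
    by (rule conj_transpose_prod_cancel) (use assms R in auto)
  then have "S \<star>\<^bsub>n,I\<^esub> R \<star>\<^bsub>n,I\<^esub> A = S \<star>\<^bsub>n,I\<^esub> R \<star>\<^bsub>n,I\<^esub> B"
    by (simp add: einstein_prod_assoc)
  then show ?thesis
    using assms R by (simp add: id_tensor_left)
qed

section \<open>Existence and uniqueness of the weighted inverse\<close>

text \<open>In the coordinates given by \<open>R\<close> and \<open>S\<close> the weights become the
  identity. \<open>A X\<close> is similar to \<open>C Y\<close> through \<open>R\<close>, and
  \<open>X A\<close> to \<open>Y C\<close> through \<open>S\<close>, so the ordinary Moore--Penrose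
  equations for \<open>C\<close> and \<open>Y\<close> translate back.\<close>

lemma ex_weighted_MP_inverse:
  assumes "A \<in> tensors n I" "hermitian_pos_def n I M" "hermitian_pos_def n I N"
  shows "\<exists>X. is_weighted_MP_inverse n I M N A X"
proof -
  obtain R R' where R: "R \<in> tensors n I" "R' \<in> tensors n I" "M = R\<^sup>H \<star>\<^bsub>n,I\<^esub> R"
    "R \<star>\<^bsub>n,I\<^esub> R' = id_tensor n I" "R' \<star>\<^bsub>n,I\<^esub> R = id_tensor n I"
    using hermitian_pos_def_factorization[OF assms(2)] .
  obtain S S' where S: "S \<in> tensors n I" "S' \<in> tensors n I" "N = S\<^sup>H \<star>\<^bsub>n,I\<^esub> S"
    "S \<star>\<^bsub>n,I\<^esub> S' = id_tensor n I" "S' \<star>\<^bsub>n,I\<^esub> S = id_tensor n I"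
    using hermitian_pos_def_factorization[OF assms(3)] .
  define C where "C = R \<star>\<^bsub>n,I\<^esub> A \<star>\<^bsub>n,I\<^esub> S'"
  have C: "C \<in> tensors n I"
    using assms(1) R S by (auto simp: C_def)
  obtain Y where Y: "Y \<in> tensors n I" "C \<star>\<^bsub>n,I\<^esub> Y \<star>\<^bsub>n,I\<^esub> C = C" "Y \<star>\<^bsub>n,I\<^esub> C \<star>\<^bsub>n,I\<^esub> Y = Y"
    "(C \<star>\<^bsub>n,I\<^esub> Y)\<^sup>H = C \<star>\<^bsub>n,I\<^esub> Y" "(Y \<star>\<^bsub>n,I\<^esub> C)\<^sup>H = Y \<star>\<^bsub>n,I\<^esub> C"
    using ex_MP_inverse[OF C] by blast
  define X where "X = S' \<star>\<^bsub>n,I\<^esub> Y \<star>\<^bsub>n,I\<^esub> R"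
  have A: "A = R' \<star>\<^bsub>n,I\<^esub> C \<star>\<^bsub>n,I\<^esub> S"
  proof -
    have "R' \<star>\<^bsub>n,I\<^esub> C \<star>\<^bsub>n,I\<^esub> S = (R' \<star>\<^bsub>n,I\<^esub> R) \<star>\<^bsub>n,I\<^esub> A \<star>\<^bsub>n,I\<^esub> (S' \<star>\<^bsub>n,I\<^esub> S)"
      by (simp add: C_def einstein_prod_assoc)
    then show ?thesis
      using assms(1) R S by (simp add: id_tensor_left id_tensor_right)
  qed
  have AX: "A \<star>\<^bsub>n,I\<^esub> X = R' \<star>\<^bsub>n,I\<^esub> (C \<star>\<^bsub>n,I\<^esub> Y) \<star>\<^bsub>n,I\<^esub> R"
  proof -
    have "A \<star>\<^bsub>n,I\<^esub> X = R' \<star>\<^bsub>n,I\<^esub> C \<star>\<^bsub>n,I\<^esub> (S \<star>\<^bsub>n,I\<^esub> S') \<star>\<^bsub>n,I\<^esub> Y \<star>\<^bsub>n,I\<^esub> R"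
      by (simp add: A X_def einstein_prod_assoc)
    then show ?thesis
      using R C S by (simp add: id_tensor_right einstein_prod_assoc)
  qed
  have XA: "X \<star>\<^bsub>n,I\<^esub> A = S' \<star>\<^bsub>n,I\<^esub> (Y \<star>\<^bsub>n,I\<^esub> C) \<star>\<^bsub>n,I\<^esub> S"
  proof -
    have "X \<star>\<^bsub>n,I\<^esub> A = S' \<star>\<^bsub>n,I\<^esub> Y \<star>\<^bsub>n,I\<^esub> (R \<star>\<^bsub>n,I\<^esub> R') \<star>\<^bsub>n,I\<^esub> C \<star>\<^bsub>n,I\<^esub> S"
      by (simp add: A X_def einstein_prod_assoc)
    then show ?thesis
      using R Y(1) S by (simp add: id_tensor_right einstein_prod_assoc)
  qed
  have "A \<star>\<^bsub>n,I\<^esub> X \<star>\<^bsub>n,I\<^esub> A = R' \<star>\<^bsub>n,I\<^esub> (C \<star>\<^bsub>n,I\<^esub> Y \<star>\<^bsub>n,I\<^esub> C) \<star>\<^bsub>n,I\<^esub> S"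
  proof -
    have "A \<star>\<^bsub>n,I\<^esub> X \<star>\<^bsub>n,I\<^esub> A = R' \<star>\<^bsub>n,I\<^esub> C \<star>\<^bsub>n,I\<^esub> Y \<star>\<^bsub>n,I\<^esub> (R \<star>\<^bsub>n,I\<^esub> R') \<star>\<^bsub>n,I\<^esub> C \<star>\<^bsub>n,I\<^esub> S"
      unfolding AX by (simp add: A einstein_prod_assoc)
    then show ?thesis
      using R C Y(1) S by (simp add: id_tensor_right einstein_prod_assoc)
  qed
  then have 1: "A \<star>\<^bsub>n,I\<^esub> X \<star>\<^bsub>n,I\<^esub> A = A"
    by (simp only: Y A)
  have "X \<star>\<^bsub>n,I\<^esub> A \<star>\<^bsub>n,I\<^esub> X = S' \<star>\<^bsub>n,I\<^esub> (Y \<star>\<^bsub>n,I\<^esub> C \<star>\<^bsub>n,I\<^esub> Y) \<star>\<^bsub>n,I\<^esub> R"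
  proof -
    have "X \<star>\<^bsub>n,I\<^esub> A \<star>\<^bsub>n,I\<^esub> X = S' \<star>\<^bsub>n,I\<^esub> Y \<star>\<^bsub>n,I\<^esub> C \<star>\<^bsub>n,I\<^esub> (S \<star>\<^bsub>n,I\<^esub> S') \<star>\<^bsub>n,I\<^esub> Y \<star>\<^bsub>n,I\<^esub> R"
      unfolding XA by (simp add: X_def einstein_prod_assoc)
    then show ?thesis
      using R C Y(1) S by (simp add: id_tensor_right einstein_prod_assoc)
  qed
  then have 2: "X \<star>\<^bsub>n,I\<^esub> A \<star>\<^bsub>n,I\<^esub> X = X"
    by (simp only: Y X_def)
  \<comment> \<open>With \<open>M = R\<^sup>H R\<close>, the factor \<open>R\<close> meets
    \<open>R'\<close>, and the similarity becomes a congruence, which preserves being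
    Hermitian.\<close>
  have "M \<star>\<^bsub>n,I\<^esub> A \<star>\<^bsub>n,I\<^esub> X = R\<^sup>H \<star>\<^bsub>n,I\<^esub> (R \<star>\<^bsub>n,I\<^esub> R') \<star>\<^bsub>n,I\<^esub> (C \<star>\<^bsub>n,I\<^esub> Y) \<star>\<^bsub>n,I\<^esub> R"
    using AX by (simp add: R(3) einstein_prod_assoc)
  then have "M \<star>\<^bsub>n,I\<^esub> A \<star>\<^bsub>n,I\<^esub> X = R\<^sup>H \<star>\<^bsub>n,I\<^esub> (C \<star>\<^bsub>n,I\<^esub> Y) \<star>\<^bsub>n,I\<^esub> R"
    using R by (simp add: id_tensor_right)
  then have 3: "(M \<star>\<^bsub>n,I\<^esub> A \<star>\<^bsub>n,I\<^esub> X)\<^sup>H = M \<star>\<^bsub>n,I\<^esub> A \<star>\<^bsub>n,I\<^esub> X"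
    using Y(4) by (simp only: hermitian_congruence)
  have "N \<star>\<^bsub>n,I\<^esub> X \<star>\<^bsub>n,I\<^esub> A = S\<^sup>H \<star>\<^bsub>n,I\<^esub> (S \<star>\<^bsub>n,I\<^esub> S') \<star>\<^bsub>n,I\<^esub> (Y \<star>\<^bsub>n,I\<^esub> C) \<star>\<^bsub>n,I\<^esub> S"
    using XA by (simp add: S(3) einstein_prod_assoc)
  then have "N \<star>\<^bsub>n,I\<^esub> X \<star>\<^bsub>n,I\<^esub> A = S\<^sup>H \<star>\<^bsub>n,I\<^esub> (Y \<star>\<^bsub>n,I\<^esub> C) \<star>\<^bsub>n,I\<^esub> S"
    using S by (simp add: id_tensor_right)
  then have 4: "(N \<star>\<^bsub>n,I\<^esub> X \<star>\<^bsub>n,I\<^esub> A)\<^sup>H = N \<star>\<^bsub>n,I\<^esub> X \<star>\<^bsub>n,I\<^esub> A"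
    using Y(5) by (simp only: hermitian_congruence)
  have "X \<in> tensors n I"
    using R S Y by (auto simp: X_def)
  with 1 2 3 4 show ?thesis
    unfolding is_weighted_MP_inverse_def by blast
qed

text \<open>Both \<open>K\<close> and \<open>L\<close> are self-adjoint for the form weighted by
  \<open>P\<close>, that is \<open>P K = K\<^sup>H P\<close> and \<open>P L = L\<^sup>H P\<close>.
  Moving \<open>P\<close> past both factors reverses their order.\<close>

lemma weighted_hermitian_prod:
  assumes "P\<^sup>H = P" "(P \<star>\<^bsub>n,I\<^esub> K)\<^sup>H = P \<star>\<^bsub>n,I\<^esub> K" "(P \<star>\<^bsub>n,I\<^esub> L)\<^sup>H = P \<star>\<^bsub>n,I\<^esub> L"
  shows "P \<star>\<^bsub>n,I\<^esub> K \<star>\<^bsub>n,I\<^esub> L = (P \<star>\<^bsub>n,I\<^esub> (L \<star>\<^bsub>n,I\<^esub> K))\<^sup>H"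
proof -
  have K: "P \<star>\<^bsub>n,I\<^esub> K = K\<^sup>H \<star>\<^bsub>n,I\<^esub> P" and L: "P \<star>\<^bsub>n,I\<^esub> L = L\<^sup>H \<star>\<^bsub>n,I\<^esub> P"
    using assms by (metis conj_transpose_prod)+
  have "P \<star>\<^bsub>n,I\<^esub> K \<star>\<^bsub>n,I\<^esub> L = K\<^sup>H \<star>\<^bsub>n,I\<^esub> (P \<star>\<^bsub>n,I\<^esub> L)"
    by (simp add: K einstein_prod_assoc)
  also have "\<dots> = K\<^sup>H \<star>\<^bsub>n,I\<^esub> L\<^sup>H \<star>\<^bsub>n,I\<^esub> P"
    by (simp add: L einstein_prod_assoc)
  also have "\<dots> = (P \<star>\<^bsub>n,I\<^esub> (L \<star>\<^bsub>n,I\<^esub> K))\<^sup>H"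
    by (simp add: conj_transpose_prod assms(1))
  finally show ?thesis .
qed

text \<open>The idempotents \<open>A X\<close> and \<open>A Y\<close> absorb each other and are
  self-adjoint for the weight \<open>M\<close>, so they coincide; the weight \<open>N\<close> does
  the same for \<open>X A\<close> and \<open>Y A\<close>.\<close>

lemma weighted_MP_inverse_unique:
  assumes A: "A \<in> tensors n I" and M: "hermitian_pos_def n I M" and N: "hermitian_pos_def n I N"
    and X: "is_weighted_MP_inverse n I M N A X" and Y: "is_weighted_MP_inverse n I M N A Y"
  shows "X = Y"
proof -
  have X': "X \<in> tensors n I" "A \<star>\<^bsub>n,I\<^esub> X \<star>\<^bsub>n,I\<^esub> A = A" "X \<star>\<^bsub>n,I\<^esub> A \<star>\<^bsub>n,I\<^esub> X = X"
    "(M \<star>\<^bsub>n,I\<^esub> (A \<star>\<^bsub>n,I\<^esub> X))\<^sup>H = M \<star>\<^bsub>n,I\<^esub> (A \<star>\<^bsub>n,I\<^esub> X)" "(N \<star>\<^bsub>n,I\<^esub> (X \<star>\<^bsub>n,I\<^esub> A))\<^sup>H = N \<star>\<^bsub>n,I\<^esub> (X \<star>\<^bsub>n,I\<^esub> A)"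
    using X unfolding is_weighted_MP_inverse_def by (simp_all add: einstein_prod_assoc)
  have Y': "Y \<in> tensors n I" "A \<star>\<^bsub>n,I\<^esub> Y \<star>\<^bsub>n,I\<^esub> A = A" "Y \<star>\<^bsub>n,I\<^esub> A \<star>\<^bsub>n,I\<^esub> Y = Y"
    "(M \<star>\<^bsub>n,I\<^esub> (A \<star>\<^bsub>n,I\<^esub> Y))\<^sup>H = M \<star>\<^bsub>n,I\<^esub> (A \<star>\<^bsub>n,I\<^esub> Y)" "(N \<star>\<^bsub>n,I\<^esub> (Y \<star>\<^bsub>n,I\<^esub> A))\<^sup>H = N \<star>\<^bsub>n,I\<^esub> (Y \<star>\<^bsub>n,I\<^esub> A)"
    using Y unfolding is_weighted_MP_inverse_def by (simp_all add: einstein_prod_assoc)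
  \<comment> \<open>Here \<open>A = A Y A\<close> is inserted on the left of \<open>X\<close>; after
    the order is reversed, \<open>A X A = A\<close> removes \<open>X\<close>.\<close>
  have "M \<star>\<^bsub>n,I\<^esub> (A \<star>\<^bsub>n,I\<^esub> X) = M \<star>\<^bsub>n,I\<^esub> (A \<star>\<^bsub>n,I\<^esub> Y) \<star>\<^bsub>n,I\<^esub> (A \<star>\<^bsub>n,I\<^esub> X)"
    using Y'(2) by (metis einstein_prod_assoc)
  also have "\<dots> = (M \<star>\<^bsub>n,I\<^esub> (A \<star>\<^bsub>n,I\<^esub> X \<star>\<^bsub>n,I\<^esub> (A \<star>\<^bsub>n,I\<^esub> Y)))\<^sup>H"
    by (intro weighted_hermitian_prod hermitian_pos_def_hermitian[OF M] X' Y')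
  also have "A \<star>\<^bsub>n,I\<^esub> X \<star>\<^bsub>n,I\<^esub> (A \<star>\<^bsub>n,I\<^esub> Y) = A \<star>\<^bsub>n,I\<^esub> Y"
    using X'(2) by (metis einstein_prod_assoc)
  finally have AX: "A \<star>\<^bsub>n,I\<^esub> X = A \<star>\<^bsub>n,I\<^esub> Y"
    unfolding Y'(4) by (rule hermitian_pos_def_cancel[OF M, rotated 2]) (intro tensors_prod A X' Y')+
  have "N \<star>\<^bsub>n,I\<^esub> (X \<star>\<^bsub>n,I\<^esub> A) = N \<star>\<^bsub>n,I\<^esub> (X \<star>\<^bsub>n,I\<^esub> A) \<star>\<^bsub>n,I\<^esub> (Y \<star>\<^bsub>n,I\<^esub> A)"
    using Y'(2) by (metis einstein_prod_assoc)
  also have "\<dots> = (N \<star>\<^bsub>n,I\<^esub> (Y \<star>\<^bsub>n,I\<^esub> A \<star>\<^bsub>n,I\<^esub> (X \<star>\<^bsub>n,I\<^esub> A)))\<^sup>H"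
    by (intro weighted_hermitian_prod hermitian_pos_def_hermitian[OF N] X' Y')
  also have "Y \<star>\<^bsub>n,I\<^esub> A \<star>\<^bsub>n,I\<^esub> (X \<star>\<^bsub>n,I\<^esub> A) = Y \<star>\<^bsub>n,I\<^esub> A"
    using X'(2) by (metis einstein_prod_assoc)
  finally have XA: "X \<star>\<^bsub>n,I\<^esub> A = Y \<star>\<^bsub>n,I\<^esub> A"
    unfolding Y'(5) by (rule hermitian_pos_def_cancel[OF N, rotated 2]) (intro tensors_prod A X' Y')+
  \<comment> \<open>The chain is \<open>X = X A X = X A Y = Y A Y = Y\<close>.\<close>
  show ?thesis
    using AX XA X'(3) Y'(3) by (metis einstein_prod_assoc)
qed

lemma weighted_MP_inverse_eqI:
  assumes "A \<in> tensors n I" "hermitian_pos_def n I M" "hermitian_pos_def n I N"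
    and "is_weighted_MP_inverse n I M N A X"
  shows "A\<^sup>\<dagger>\<^bsub>n,I;M,N\<^esub> = X"
  unfolding weighted_MP_inverse_def
  using assms weighted_MP_inverse_unique by (intro the_equality) auto

lemma is_weighted_MP_inverse_weighted_MP_inverse:
  assumes "A \<in> tensors n I" "hermitian_pos_def n I M" "hermitian_pos_def n I N"
  shows "is_weighted_MP_inverse n I M N A (A\<^sup>\<dagger>\<^bsub>n,I;M,N\<^esub>)"
  using ex_weighted_MP_inverse[OF assms] weighted_MP_inverse_eqI[OF assms] by metis

section \<open>The reverse order law\<close>

theorem theorem4p2:
  fixes n :: nat and I :: "nat \<Rightarrow> nat" and A B M N :: tensor
  assumes "A \<in> tensors n I" and "B \<in> tensors n I"
    and "hermitian_pos_def n I M" and "hermitian_pos_def n I N"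
    and "(M \<star>\<^bsub>n,I\<^esub> A \<star>\<^bsub>n,I\<^esub> B \<star>\<^bsub>n,I\<^esub> B\<^sup>\<dagger>\<^bsub>n,I;M,N\<^esub> \<star>\<^bsub>n,I\<^esub> A\<^sup>\<dagger>\<^bsub>n,I;M,N\<^esub>)\<^sup>H
         = M \<star>\<^bsub>n,I\<^esub> A \<star>\<^bsub>n,I\<^esub> B \<star>\<^bsub>n,I\<^esub> B\<^sup>\<dagger>\<^bsub>n,I;M,N\<^esub> \<star>\<^bsub>n,I\<^esub> A\<^sup>\<dagger>\<^bsub>n,I;M,N\<^esub>"
    and "B \<star>\<^bsub>n,I\<^esub> (A\<^sup>\<dagger>\<^bsub>n,I;M,N\<^esub> \<star>\<^bsub>n,I\<^esub> A) = (A\<^sup>\<dagger>\<^bsub>n,I;M,N\<^esub> \<star>\<^bsub>n,I\<^esub> A) \<star>\<^bsub>n,I\<^esub> B"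
    and "B\<^sup>\<dagger>\<^bsub>n,I;M,N\<^esub> \<star>\<^bsub>n,I\<^esub> (A\<^sup>\<dagger>\<^bsub>n,I;M,N\<^esub> \<star>\<^bsub>n,I\<^esub> A)
         = (A\<^sup>\<dagger>\<^bsub>n,I;M,N\<^esub> \<star>\<^bsub>n,I\<^esub> A) \<star>\<^bsub>n,I\<^esub> B\<^sup>\<dagger>\<^bsub>n,I;M,N\<^esub>"
  shows "(A \<star>\<^bsub>n,I\<^esub> B)\<^sup>\<dagger>\<^bsub>n,I;M,N\<^esub> = B\<^sup>\<dagger>\<^bsub>n,I;M,N\<^esub> \<star>\<^bsub>n,I\<^esub> A\<^sup>\<dagger>\<^bsub>n,I;M,N\<^esub>"
proof -
  define X where "X = A\<^sup>\<dagger>\<^bsub>n,I;M,N\<^esub>"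
  define Y where "Y = B\<^sup>\<dagger>\<^bsub>n,I;M,N\<^esub>"
  \<comment> \<open>This idempotent is what (ii) and (iii) allow to commute with \<open>B\<close>
    and \<open>Y\<close>; it satisfies \<open>A P = A\<close> and \<open>P X = X\<close>.\<close>
  define P where "P = X \<star>\<^bsub>n,I\<^esub> A"
  have MP: "is_weighted_MP_inverse n I M N A X" "is_weighted_MP_inverse n I M N B Y"
    unfolding X_def Y_def using assms(1-4) by (auto intro: is_weighted_MP_inverse_weighted_MP_inverse)
  have X: "X \<in> tensors n I" "A \<star>\<^bsub>n,I\<^esub> P = A" "P \<star>\<^bsub>n,I\<^esub> X = X" "(N \<star>\<^bsub>n,I\<^esub> P)\<^sup>H = N \<star>\<^bsub>n,I\<^esub> P"
    and Y: "Y \<in> tensors n I" "B \<star>\<^bsub>n,I\<^esub> Y \<star>\<^bsub>n,I\<^esub> B = B" "Y \<star>\<^bsub>n,I\<^esub> B \<star>\<^bsub>n,I\<^esub> Y = Y" "(N \<star>\<^bsub>n,I\<^esub> (Y \<star>\<^bsub>n,I\<^esub> B))\<^sup>H = N \<star>\<^bsub>n,I\<^esub> (Y \<star>\<^bsub>n,I\<^esub> B)"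
    using MP unfolding is_weighted_MP_inverse_def P_def by (simp_all add: einstein_prod_assoc)
  have BP: "B \<star>\<^bsub>n,I\<^esub> P = P \<star>\<^bsub>n,I\<^esub> B" and YP: "Y \<star>\<^bsub>n,I\<^esub> P = P \<star>\<^bsub>n,I\<^esub> Y"
    using assms(6,7) unfolding P_def X_def Y_def .
  \<comment> \<open>\<open>P\<close> moves left past \<open>Y\<close> and \<open>B\<close> until
    \<open>A\<close> absorbs it, leaving \<open>B Y B\<close>.\<close>
  have "A \<star>\<^bsub>n,I\<^esub> B \<star>\<^bsub>n,I\<^esub> (Y \<star>\<^bsub>n,I\<^esub> X) \<star>\<^bsub>n,I\<^esub> (A \<star>\<^bsub>n,I\<^esub> B) = A \<star>\<^bsub>n,I\<^esub> B \<star>\<^bsub>n,I\<^esub> (Y \<star>\<^bsub>n,I\<^esub> P) \<star>\<^bsub>n,I\<^esub> B"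
    by (simp add: P_def einstein_prod_assoc)
  also have "\<dots> = A \<star>\<^bsub>n,I\<^esub> (B \<star>\<^bsub>n,I\<^esub> P) \<star>\<^bsub>n,I\<^esub> Y \<star>\<^bsub>n,I\<^esub> B"
    unfolding YP by (simp add: einstein_prod_assoc)
  also have "\<dots> = A \<star>\<^bsub>n,I\<^esub> P \<star>\<^bsub>n,I\<^esub> (B \<star>\<^bsub>n,I\<^esub> Y \<star>\<^bsub>n,I\<^esub> B)"
    unfolding BP by (simp add: einstein_prod_assoc)
  finally have 1: "A \<star>\<^bsub>n,I\<^esub> B \<star>\<^bsub>n,I\<^esub> (Y \<star>\<^bsub>n,I\<^esub> X) \<star>\<^bsub>n,I\<^esub> (A \<star>\<^bsub>n,I\<^esub> B) = A \<star>\<^bsub>n,I\<^esub> B"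
    by (simp only: X Y)
  \<comment> \<open>\<open>P\<close> moves left past \<open>Y\<close> to free \<open>Y B Y\<close>,
    then returns to the right to be absorbed by \<open>X\<close>.\<close>
  have "Y \<star>\<^bsub>n,I\<^esub> X \<star>\<^bsub>n,I\<^esub> (A \<star>\<^bsub>n,I\<^esub> B) \<star>\<^bsub>n,I\<^esub> (Y \<star>\<^bsub>n,I\<^esub> X) = Y \<star>\<^bsub>n,I\<^esub> P \<star>\<^bsub>n,I\<^esub> B \<star>\<^bsub>n,I\<^esub> Y \<star>\<^bsub>n,I\<^esub> X"
    by (simp add: P_def einstein_prod_assoc)
  also have "\<dots> = P \<star>\<^bsub>n,I\<^esub> (Y \<star>\<^bsub>n,I\<^esub> B \<star>\<^bsub>n,I\<^esub> Y) \<star>\<^bsub>n,I\<^esub> X"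
    unfolding YP by (simp add: einstein_prod_assoc)
  also have "\<dots> = Y \<star>\<^bsub>n,I\<^esub> (P \<star>\<^bsub>n,I\<^esub> X)"
    by (simp only: Y YP[symmetric] einstein_prod_assoc[of n I Y P X])
  finally have 2: "Y \<star>\<^bsub>n,I\<^esub> X \<star>\<^bsub>n,I\<^esub> (A \<star>\<^bsub>n,I\<^esub> B) \<star>\<^bsub>n,I\<^esub> (Y \<star>\<^bsub>n,I\<^esub> X) = Y \<star>\<^bsub>n,I\<^esub> X"
    by (simp only: X)
  \<comment> \<open>Hypothesis (i) up to bracketing.\<close>
  have 3: "(M \<star>\<^bsub>n,I\<^esub> (A \<star>\<^bsub>n,I\<^esub> B) \<star>\<^bsub>n,I\<^esub> (Y \<star>\<^bsub>n,I\<^esub> X))\<^sup>H = M \<star>\<^bsub>n,I\<^esub> (A \<star>\<^bsub>n,I\<^esub> B) \<star>\<^bsub>n,I\<^esub> (Y \<star>\<^bsub>n,I\<^esub> X)"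
    using assms(5) unfolding X_def Y_def by (simp only: einstein_prod_assoc)
  have comm: "Y \<star>\<^bsub>n,I\<^esub> B \<star>\<^bsub>n,I\<^esub> P = P \<star>\<^bsub>n,I\<^esub> (Y \<star>\<^bsub>n,I\<^esub> B)"
    by (metis BP YP einstein_prod_assoc)
  have "N \<star>\<^bsub>n,I\<^esub> (Y \<star>\<^bsub>n,I\<^esub> X) \<star>\<^bsub>n,I\<^esub> (A \<star>\<^bsub>n,I\<^esub> B) = N \<star>\<^bsub>n,I\<^esub> (Y \<star>\<^bsub>n,I\<^esub> P) \<star>\<^bsub>n,I\<^esub> B"
    by (simp add: P_def einstein_prod_assoc)
  also have "\<dots> = N \<star>\<^bsub>n,I\<^esub> P \<star>\<^bsub>n,I\<^esub> (Y \<star>\<^bsub>n,I\<^esub> B)"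
    unfolding YP by (simp add: einstein_prod_assoc)
  finally have NYX: "N \<star>\<^bsub>n,I\<^esub> (Y \<star>\<^bsub>n,I\<^esub> X) \<star>\<^bsub>n,I\<^esub> (A \<star>\<^bsub>n,I\<^esub> B) = N \<star>\<^bsub>n,I\<^esub> P \<star>\<^bsub>n,I\<^esub> (Y \<star>\<^bsub>n,I\<^esub> B)" .
  \<comment> \<open>\<open>P\<close> and \<open>Y B\<close> are self-adjoint for the weight
    \<open>N\<close> and commute by \<open>comm\<close>, so their product is self-adjoint
    too.\<close>
  have 4: "(N \<star>\<^bsub>n,I\<^esub> (Y \<star>\<^bsub>n,I\<^esub> X) \<star>\<^bsub>n,I\<^esub> (A \<star>\<^bsub>n,I\<^esub> B))\<^sup>H = N \<star>\<^bsub>n,I\<^esub> (Y \<star>\<^bsub>n,I\<^esub> X) \<star>\<^bsub>n,I\<^esub> (A \<star>\<^bsub>n,I\<^esub> B)"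
    unfolding NYX using weighted_hermitian_prod[OF hermitian_pos_def_hermitian[OF assms(4)] X(4) Y(4)] comm
    by (metis conj_transpose_conj_transpose einstein_prod_assoc)
  have "is_weighted_MP_inverse n I M N (A \<star>\<^bsub>n,I\<^esub> B) (Y \<star>\<^bsub>n,I\<^esub> X)"
    using 1 2 3 4 X(1) Y(1) unfolding is_weighted_MP_inverse_def by blast
  then show ?thesis
    using weighted_MP_inverse_eqI[of "A \<star>\<^bsub>n,I\<^esub> B" n I M N "Y \<star>\<^bsub>n,I\<^esub> X"] assms(1-4) unfolding X_def Y_def by auto
qed

end
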